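(* Let $\bar{\mathbb{N}}$ be an invertible antisymmetric real $2k\times2k$ matrix and $d\ge1$. Let $h=h(\mathcal{X},\mathcal{K},\mathcal{M})$ be a smooth Hamiltonian on $\mathfrak{jac}^*(\mathbb{R}^{2k},-\bar{\mathbb{N}}^{-1};\mathbb{R}^d)$ and define the collective Hamiltonian $\tilde h:=h\circ\Psi$ on $\widetilde{\mathfrak{h}}^*(\mathbb{R}^{2k},-\bar{\mathbb{N}}^{-1};\mathbb{R}^d)$, where $$\Psi(\mathcal{K}',\mathcal{M}')=\Big(-\tfrac12\,\bar{\mathbb{N}}\,\mathcal{K}'^T\mathcal{M}'^{-1}\mathcal{K}',\ \mathcal{K}',\ \mathcal{M}'\Big).$$ Let $\mathcal{K}'(t),\mathcal{M}'(t)$ (with $\mathcal{M}'$ invertible) be a solution of the collective Hamilton's equations $$\dot{\mathcal{K}}'=-\mathcal{M}'\Big(\frac{\delta\tilde h}{\delta\mathcal{K}'}\Big)^{T}\bar{\mathbb{N}}^{-1},\qquad \dot{\mathcal{M}}'=0 .$$ Then $$(\mathcal{X},\mathcal{K},\mathcal{M})=\Big(-\tfrac12\,\bar{\mathbb{N}}\,\mathcal{K}'^T\mathcal{M}'^{-1}\mathcal{K}',\ \mathcal{K}',\ \mathcal{M}'\Big)$$ is a solution of the Lie--Poisson equations on the dual Jacobi Lie algebra $$\dot{\mathcal{X}}=\Big[\mathcal{X},\frac{\delta h}{\delta\mathcal{X}}\Big]-\frac{\delta h}{\delta\mathcal{K}}\diamond\mathcal{K},\qquad \dot{\mathcal{K}}=\mathcal{K}\frac{\delta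 h}{\delta\mathcal{X}}-\mathcal{M}\Big(\frac{\delta h}{\delta\mathcal{K}}\Big)^{T}\bar{\mathbb{N}}^{-1},\qquad\dot{\mathcal{M}}=0 .$$
   Context: Put $\mathbb{J}=-\bar{\mathbb{N}}^{-1}$ and $\mathfrak{sp}(\mathbb{R}^{2k},\mathbb{J})=\{\mathcal{S}:\mathbb{J}\mathcal{S}+\mathcal{S}^T\mathbb{J}=0\}$. The dual of the generalized Jacobi Lie algebra $\mathfrak{jac}(\mathbb{R}^{2k},\mathbb{J};\mathbb{R}^d)=\mathfrak{sp}(\mathbb{R}^{2k},\mathbb{J})\times\mathcal{M}_{2k\times d}\times\operatorname{Sym}(\mathbb{R}^d)\ni(\mathcal{S},\mathcal{A},\mathcal{B})$ (with $\mathcal{M}_{p\times q}$ the real $p\times q$ matrices) is identified with $\mathfrak{sp}(\mathbb{R}^{2k},\mathbb{J})\times\mathcal{M}_{d\times2k}\times\operatorname{Sym}(\mathbb{R}^d)\ni(\mathcal{X},\mathcal{K},\mathcal{M})$ via the pairing $\operatorname{Tr}(\mathcal{X}\mathcal{S})+\operatorname{Tr}(\mathcal{K}\mathcal{A})+\operatorname{Tr}(\mathcal{M}\mathcal{B})$; the derivatives $\delta h/\delta\mathcal{X}\in\mathfrak{sp}(\mathbb{R}^{2k},\mathbb{J})$, $\delta h/\delta\mathcal{K}\in\mathcal{M}_{2k\times d}$ (and likewise $\delta\tilde h/\delta\mathcal{K}'$) are taken with respect to this pairing. $\widetilde{\mathfrak{h}}^*(\mathbb{R}^{2k},\mathbb{J};\mathbb{R}^d)=\{(\mathcal{K},\mathcal{M})\in\mathcal{M}_{d\times2k}\times\operatorname{Sym}(\mathbb{R}^d):\det\mathcal{M}\neq0\}$.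 The operator $\diamond:\mathcal{M}_{2k\times d}\times\mathcal{M}_{d\times2k}\to\mathfrak{sp}(\mathbb{R}^{2k},\mathbb{J})$ is defined by $\operatorname{Tr}((\mathcal{A}\diamond\mathcal{K})\mathcal{S})=\operatorname{Tr}(\mathcal{K}\mathcal{S}\mathcal{A})$ for all $\mathcal{S}\in\mathfrak{sp}(\mathbb{R}^{2k},\mathbb{J})$; explicitly $\mathcal{A}\diamond\mathcal{K}=(\mathcal{A}\mathcal{K}\bar{\mathbb{N}})^{\rm sym}\bar{\mathbb{N}}^{-1}$ with $M^{\rm sym}=\frac12(M+M^T)$. *)

theory Defs
  imports "HOL-Analysis.Analysis"
begin

text \<open>A real matrix with rows indexed by \<open>'a\<close> and columns by \<open>'b\<close> has type \<open>real^'b^'a\<close>.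
  Throughout, \<open>'n\<close> is the index type of \<open>\<real>\<^sup>2\<^sup>k\<close> and \<open>'d\<close> that of \<open>\<real>\<^sup>d\<close>.\<close>

definition sp_alg :: "real^'n^'n \<Rightarrow> (real^'n^'n) set" where
  "sp_alg J = {S. J ** S + transpose S ** J = 0}"

definition sym_mats :: "(real^'d^'d) set" where
  "sym_mats = {M. transpose M = M}"

definition sym_part :: "real^'n^'n \<Rightarrow> real^'n^'n" where
  "sym_part A = (1/2) *\<^sub>R (A + transpose A)"

definition jac_dual ::
  "real^'n^'n \<Rightarrow> ((real^'n^'n) \<times> (real^'n^'d) \<times> (real^'d^'d)) set" where
  "jac_dual J = sp_alg J \<times> UNIV \<times> sym_mats"

text \<open>As a set, this does not depend on the form \<open>J\<close>.\<close>

definition heis_dual_nondeg :: "((real^'n^'d) \<times> (real^'d^'d)) set" where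
  "heis_dual_nondeg = {(K, M). M \<in> sym_mats \<and> det M \<noteq> 0}"

text \<open>\<open>C\<^sup>n\<close> functions on a finite-dimensional linear subspace \<open>V\<close>, by recursion on directional
  derivatives.  Only directions \<open>v \<in> V\<close> are used: a derivative within \<open>V\<close> is uniquely
  determined on \<open>V\<close>, but not outside it.  Values of \<open>f\<close> outside \<open>V\<close> are irrelevant.\<close>

primrec Cn_on :: "nat \<Rightarrow> 'a::euclidean_space set \<Rightarrow> ('a \<Rightarrow> real) \<Rightarrow> bool" where
  "Cn_on 0 V f \<longleftrightarrow> continuous_on V f"
| "Cn_on (Suc n) V f \<longleftrightarrow>
     (\<forall>x\<in>V. f differentiable (at x within V)) \<and>
     (\<forall>v\<in>V. Cn_on n V (\<lambda>x. frechet_derivative f (at x within V) v))"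

definition smooth_on_subspace :: "'a::euclidean_space set \<Rightarrow> ('a \<Rightarrow> real) \<Rightarrow> bool" where
  "smooth_on_subspace V f \<longleftrightarrow> (\<forall>n. Cn_on n V f)"

text \<open>The derivative at \<open>x \<in> V\<close> of \<open>f : V \<rightarrow> \<real>\<close>, represented by an element of \<open>W\<close>, where
  \<open>W\<close> and \<open>V\<close> are dual to each other under the trace pairing.\<close>

definition trace_derivative ::
  "(real^'b^'a) set \<Rightarrow> (real^'a^'b) set \<Rightarrow> (real^'b^'a \<Rightarrow> real) \<Rightarrow> real^'b^'a \<Rightarrow> real^'a^'b" where
  "trace_derivative V W f x =
     (THE A. A \<in> W \<and> (f has_derivative (\<lambda>v. trace (v ** A))) (at x within V))"

definition delta_X ::
  "real^'n^'n \<Rightarrow> ((real^'n^'n) \<times> (real^'n^'d) \<times> (real^'d^'d) \<Rightarrow> real) \<Rightarrow>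
   real^'n^'n \<Rightarrow> real^'n^'d \<Rightarrow> real^'d^'d \<Rightarrow> real^'n^'n" where
  "delta_X J h X K M = trace_derivative (sp_alg J) (sp_alg J) (\<lambda>Y. h (Y, K, M)) X"

definition delta_K ::
  "((real^'n^'n) \<times> (real^'n^'d) \<times> (real^'d^'d) \<Rightarrow> real) \<Rightarrow>
   real^'n^'n \<Rightarrow> real^'n^'d \<Rightarrow> real^'d^'d \<Rightarrow> real^'d^'n" where
  "delta_K h X K M = trace_derivative UNIV UNIV (\<lambda>L. h (X, L, M)) K"

definition heis_delta_K ::
  "((real^'n^'d) \<times> (real^'d^'d) \<Rightarrow> real) \<Rightarrow> real^'n^'d \<Rightarrow> real^'d^'d \<Rightarrow> real^'d^'n" where
  "heis_delta_K g K M = trace_derivative UNIV UNIV (\<lambda>L. g (L, M)) K"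

definition diamond :: "real^'n^'n \<Rightarrow> real^'d^'n \<Rightarrow> real^'n^'d \<Rightarrow> real^'n^'n" where
  "diamond J A K =
     (THE X. X \<in> sp_alg J \<and> (\<forall>S \<in> sp_alg J. trace (X ** S) = trace (K ** S ** A)))"

definition Psi ::
  "real^'n^'n \<Rightarrow> (real^'n^'d) \<times> (real^'d^'d) \<Rightarrow> (real^'n^'n) \<times> (real^'n^'d) \<times> (real^'d^'d)" where
  "Psi N = (\<lambda>(K, M). (-(1/2) *\<^sub>R (N ** transpose K ** matrix_inv M ** K), K, M))"

definition collective_solution ::
  "real^'n^'n \<Rightarrow> ((real^'n^'d) \<times> (real^'d^'d) \<Rightarrow> real) \<Rightarrow> real set \<Rightarrow>
   (real \<Rightarrow> real^'n^'d) \<Rightarrow> (real \<Rightarrow> real^'d^'d) \<Rightarrow> bool" where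
  "collective_solution N g I K M \<longleftrightarrow>
     (\<forall>t\<in>I. (K t, M t) \<in> heis_dual_nondeg \<and>
       (K has_vector_derivative
          - (M t ** transpose (heis_delta_K g (K t) (M t)) ** matrix_inv N)) (at t within I) \<and>
       (M has_vector_derivative 0) (at t within I))"

definition lie_poisson_solution ::
  "real^'n^'n \<Rightarrow> ((real^'n^'n) \<times> (real^'n^'d) \<times> (real^'d^'d) \<Rightarrow> real) \<Rightarrow> real set \<Rightarrow>
   (real \<Rightarrow> real^'n^'n) \<Rightarrow> (real \<Rightarrow> real^'n^'d) \<Rightarrow> (real \<Rightarrow> real^'d^'d) \<Rightarrow> bool" where
  "lie_poisson_solution N h I X K M \<longleftrightarrow>
     (let J = - matrix_inv N;
          dX = (\<lambda>t. delta_X J h (X t) (K t) (M t));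
          dK = (\<lambda>t. delta_K h (X t) (K t) (M t))
      in \<forall>t\<in>I. (X t, K t, M t) \<in> jac_dual J \<and>
       (X has_vector_derivative
          (X t ** dX t - dX t ** X t) - diamond J (dK t) (K t)) (at t within I) \<and>
       (K has_vector_derivative
          K t ** dX t - M t ** transpose (dK t) ** matrix_inv N) (at t within I) \<and>
       (M has_vector_derivative 0) (at t within I))"

lemma matrix_mul_neg_left: "(- A) ** B = - (A ** B)"
  for A :: "real^'b^'a" and B :: "real^'c^'b"
  by (simp add: matrix_matrix_mult_def vec_eq_iff sum_negf)

lemma matrix_mul_neg_right: "A ** (- B) = - (A ** B)"
  for A :: "real^'b^'a" and B :: "real^'c^'b"
  by (simp add: matrix_matrix_mult_def vec_eq_iff sum_negf)

lemma matrix_add_rdistrib: "(A + B) ** C = A ** C + B ** C"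
  for A :: "real^'b^'a" and C :: "real^'c^'b"
  by (simp add: matrix_matrix_mult_def vec_eq_iff algebra_simps sum.distrib)

lemma matrix_diff_rdistrib: "(A - B) ** C = A ** C - B ** C"
  for A :: "real^'b^'a" and C :: "real^'c^'b"
  by (simp add: matrix_matrix_mult_def vec_eq_iff algebra_simps sum_subtractf)

lemma transpose_minus: "transpose (- A) = - transpose A" for A :: "real^'b^'a"
  by (simp add: transpose_def vec_eq_iff)

lemma transpose_plus: "transpose (A + B) = transpose A + transpose B" for A :: "real^'b^'a"
  by (simp add: transpose_def vec_eq_iff)

lemma trace_transpose: "trace (transpose A) = trace A" for A :: "real^'n^'n"
  by (simp add: trace_def transpose_def)

lemma trace_minus: "trace (- A) = - trace A" for A :: "real^'n^'n"
  by (simp add: trace_def sum_negf)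

lemma trace_scaleR: "trace (c *\<^sub>R A) = c * trace A" for A :: "real^'n^'n"
  by (simp add: trace_def sum_distrib_left)

lemma trace_mul_transpose_eq_0: "trace (A ** transpose A) = 0 \<Longrightarrow> A = 0" for A :: "real^'n^'n"
  by (simp add: trace_def matrix_matrix_mult_def transpose_def vec_eq_iff
      sum_nonneg_eq_0_iff sum_nonneg)

lemma matrix_inv_antisym:
  fixes N :: "real^'n^'n"
  assumes "invertible N" "transpose N = - N"
  shows "transpose (matrix_inv N) = - matrix_inv N"
proof -
  let ?P = "matrix_inv N"
  have 1: "N ** ?P = mat 1" "?P ** N = mat 1"
    using assms(1) by (simp_all add: invertible_def matrix_inv_def) (metis (mono_tags, lifting) someI_ex)+
  have "- (transpose ?P ** N) = mat 1"
    using arg_cong[OF 1(1), of transpose] assms(2)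
    by (simp add: matrix_transpose_mul matrix_mul_neg_right)
  hence "- (transpose ?P ** N) ** ?P = ?P" by simp
  thus ?thesis
    using 1 by (simp add: matrix_mul_neg_left matrix_mul_assoc[symmetric]) (metis minus_minus)
qed

lemma sp_alg_iff:
  fixes N :: "real^'n^'n"
  assumes "invertible N" "transpose N = - N"
  shows "S \<in> sp_alg (- matrix_inv N) \<longleftrightarrow> S = - (N ** transpose S ** matrix_inv N)"
proof -
  let ?P = "matrix_inv N"
  have 1: "N ** ?P = mat 1" "?P ** N = mat 1"
    using assms(1) by (simp_all add: invertible_def matrix_inv_def) (metis (mono_tags, lifting) someI_ex)+
  have "S \<in> sp_alg (- ?P) \<longleftrightarrow> ?P ** S = - (transpose S ** ?P)"
    by (auto simp: sp_alg_def matrix_mul_neg_left matrix_mul_neg_right)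
       (metis add.inverse_inverse eq_neg_iff_add_eq_0 neg_eq_iff_add_eq_0 add.commute)+
  also have "\<dots> \<longleftrightarrow> N ** (?P ** S) = N ** (- (transpose S ** ?P))"
    using 1 by (metis matrix_mul_assoc matrix_mul_lid)
  also have "\<dots> \<longleftrightarrow> S = - (N ** transpose S ** ?P)"
    using 1 by (simp add: matrix_mul_assoc matrix_mul_neg_right)
  finally show ?thesis .
qed

lemma diamond_explicit:
  fixes N :: "real^'n^'n" and A :: "real^'d^'n"
  assumes N: "invertible N" "transpose N = - N"
  shows "diamond (- matrix_inv N) A K = sym_part (A ** K ** N) ** matrix_inv N"
proof -
  let ?P = "matrix_inv N" and ?E = "sym_part (A ** K ** N) ** matrix_inv N"
  have 1: "N ** ?P = mat 1" "?P ** N = mat 1"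
    using N(1) by (simp_all add: invertible_def matrix_inv_def) (metis (mono_tags, lifting) someI_ex)+
  have TP: "transpose ?P = - ?P" using matrix_inv_antisym[OF N] .
  note sp = sp_alg_iff[OF N]
  define T where "T = (\<lambda>W :: real^'n^'n. - (N ** transpose W ** ?P))"
  have canc: "B ** N ** ?P = B" "B ** ?P ** N = B" for B :: "real^'n^'m"
    using 1 by (metis matrix_mul_assoc matrix_mul_rid)+
  have TT: "T (T W) = W" for W
    using 1 by (simp add: T_def transpose_minus matrix_transpose_mul N(2) TP matrix_mul_neg_left
        matrix_mul_neg_right matrix_mul_assoc canc)
  have Tadd: "T (V + W) = T V + T W" for V W
    by (simp add: T_def transpose_plus matrix_add_ldistrib matrix_add_rdistrib)
  have Tsc: "T (c *\<^sub>R W) = c *\<^sub>R T W" for c W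
    by (simp add: T_def transpose_scalar scalar_matrix_assoc matrix_scalar_ac)
  have trT: "trace (V ** T W) = trace (T V ** W)" for V W
  proof -
    have "trace (V ** T W) = - trace (V ** N ** transpose W ** ?P)"
      by (simp add: T_def matrix_mul_neg_right trace_minus matrix_mul_assoc)
    also have "\<dots> = - trace (transpose (V ** N ** transpose W ** ?P))"
      by (simp add: trace_transpose)
    also have "\<dots> = - trace (?P ** (W ** N ** transpose V))"
      by (simp add: matrix_transpose_mul N(2) TP matrix_mul_neg_left matrix_mul_neg_right matrix_mul_assoc)
    also have "\<dots> = - trace (W ** (N ** transpose V ** ?P))"
      by (subst trace_mul_sym) (simp add: matrix_mul_assoc)
    also have "\<dots> = trace (T V ** W)"
      by (subst trace_mul_sym) (simp add: T_def matrix_mul_neg_left trace_minus)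
    finally show ?thesis .
  qed
  have E: "?E = (1/2) *\<^sub>R (A ** K + T (A ** K))"
    by (simp add: sym_part_def T_def scalar_matrix_assoc[symmetric] matrix_add_rdistrib
        matrix_diff_rdistrib canc
        matrix_transpose_mul N(2) matrix_mul_neg_left matrix_mul_assoc)
  have sp': "S \<in> sp_alg (- ?P) \<longleftrightarrow> S = T S" for S by (simp add: sp T_def)
  show ?thesis unfolding diamond_def
  proof (rule the_equality, intro conjI ballI)
    show "?E \<in> sp_alg (- ?P)"
      unfolding sp' E by (simp add: Tadd Tsc TT add.commute)
  next
    fix S assume "S \<in> sp_alg (- ?P)"
    hence S: "T S = S" by (simp add: sp')
    have "trace (T (A ** K) ** S) = trace (A ** K ** S)" using trT[of "A ** K" S] S by simp
    hence "trace (?E ** S) = trace (A ** K ** S)"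
      by (simp add: E scalar_matrix_assoc[symmetric] matrix_add_rdistrib trace_scaleR trace_add)
    also have "\<dots> = trace (K ** S ** A)"
      by (metis trace_mul_sym matrix_mul_assoc)
    finally show "trace (?E ** S) = trace (K ** S ** A)" .
  next
    fix X assume X: "X \<in> sp_alg (- ?P) \<and> (\<forall>S\<in>sp_alg (- ?P). trace (X ** S) = trace (K ** S ** A))"
    define Z where "Z = X - ?E"
    have TE: "T ?E = ?E" unfolding E by (simp add: Tadd Tsc TT add.commute)
    have Tdiff: "T (V - W) = T V - T W" for V W
      using Tadd[of V "- 1 *\<^sub>R W"] Tsc[of "-1" W] by simp
    have TZ: "T Z = Z" using X TE by (simp add: Z_def Tdiff sp')
    have 0: "trace (Z ** S) = 0" if S: "T S = S" for S
    proof -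
      have "trace (T (A ** K) ** S) = trace (A ** K ** S)" using trT[of "A ** K" S] S by simp
      hence "trace (?E ** S) = trace (A ** K ** S)"
        by (simp add: E scalar_matrix_assoc[symmetric] matrix_add_rdistrib trace_scaleR trace_add)
      also have "\<dots> = trace (K ** S ** A)"
        by (metis trace_mul_sym matrix_mul_assoc)
      also have "\<dots> = trace (X ** S)" using X S by (simp add: sp')
      finally have "trace (?E ** S) = trace (X ** S)" .
      moreover have "X ** S = Z ** S + ?E ** S"
        by (simp add: Z_def flip: matrix_add_rdistrib)
      ultimately show ?thesis by (simp add: trace_add)
    qed
    have "trace (Z ** ((1/2) *\<^sub>R (transpose Z + T (transpose Z)))) = 0"
      by (rule 0) (simp add: Tadd Tsc TT add.commute)
    hence "trace (Z ** transpose Z) = 0"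
      by (simp add: matrix_scalar_ac matrix_add_ldistrib scalar_matrix_assoc[symmetric]
          trace_scaleR trace_add trT TZ)
    thus "X = ?E" using trace_mul_transpose_eq_0[of Z] by (simp add: Z_def)
  qed
qed

end

theory Submission
  imports Defs
begin

text \<open>On the image of \<open>Psi N\<close> the chain rule, applied to the quadratic map
  \<open>K \<mapsto> -\<^sup>1/\<^sub>2 N K\<^sup>T M\<^sup>-\<^sup>1 K\<close>, expresses the collective derivative through the partial derivatives
  of \<open>h\<close>: \<open>heis_delta_K (h \<circ> Psi N) K M = \<delta>h/\<delta>K - \<delta>h/\<delta>X N K\<^sup>T M\<^sup>-\<^sup>1\<close>.  Substituted into the
  collective equation, this yields the Lie--Poisson equation for \<open>K\<close>, because
  \<open>N (\<delta>h/\<delta>X)\<^sup>T = - \<delta>h/\<delta>X N\<close>.  As \<open>M\<close> is constant on the interval, differentiating the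
  quadratic map along \<open>K\<close> yields the equation for \<open>X\<close>.\<close>

section \<open>Matrix operations as bounded (bi)linear maps, and the trace pairing\<close>

lemma bounded_bilinear_matrix_mul:
  "bounded_bilinear (\<lambda>(A::real^'b^'a) (B::real^'c^'b). A ** B)"
  by (simp add: bilinear_conv_bounded_bilinear[symmetric] bilinear_def linear_iff
      matrix_add_ldistrib matrix_add_rdistrib scalar_matrix_assoc matrix_scalar_ac)

lemma matrix_diff_ldistrib: "A ** (B - C) = A ** B - A ** C"
  for A :: "real^'b^'a" and B :: "real^'c^'b"
  by (rule bounded_bilinear.diff_right[OF bounded_bilinear_matrix_mul])

lemma bounded_linear_transpose: "bounded_linear (transpose :: real^'b^'a \<Rightarrow> real^'a^'b)"
  by (simp add: linear_conv_bounded_linear[symmetric] linear_iff transpose_plus transpose_scalar)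

lemma transpose_diff: "transpose (A - B) = transpose A - transpose B" for A B :: "real^'b^'a"
  by (rule linear_diff[OF bounded_linear.linear[OF bounded_linear_transpose]])

lemma bounded_linear_trace: "bounded_linear (trace :: real^'n^'n \<Rightarrow> real)"
  by (simp add: linear_conv_bounded_linear[symmetric] linear_iff trace_add trace_scaleR)

lemma inner_eq_trace: "A \<bullet> B = trace (A ** transpose B)" for A B :: "real^'b^'a"
  by (simp add: inner_vec_def trace_def matrix_matrix_mult_def transpose_def)

text \<open>Riesz representation: \<open>adjoint D 1\<close> is the gradient for the Euclidean inner
  product, and transposing it turns that inner product into the trace pairing.\<close>

lemma linear_functional_eq_trace:
  fixes D :: "real^'b^'a \<Rightarrow> real"
  assumes "linear D"
  obtains B where "\<And>V. D V = trace (V ** B)"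
proof
  fix V
  show "D V = trace (V ** transpose (adjoint D 1))"
    using adjoint_works[OF assms, of V 1] by (simp add: inner_eq_trace[symmetric] inner_commute)
qed

section \<open>Derivatives within a subspace and their trace representatives\<close>

text \<open>Restricting \<open>f\<close> to the line \<open>x + s *\<^sub>R v\<close>, which stays
  in \<open>V\<close>, reduces the claim to uniqueness of the derivative of a function of one real
  variable.\<close>

lemma has_derivative_within_subspace_unique:
  fixes f :: "'a::real_normed_vector \<Rightarrow> 'b::real_normed_vector"
  assumes V: "subspace V" "x \<in> V" "v \<in> V"
    and D: "(f has_derivative D) (at x within V)" "(f has_derivative E) (at x within V)"
  shows "D v = E v"
proof -
  have "((\<lambda>s. f (x + s *\<^sub>R v)) has_derivative (\<lambda>s. F (s *\<^sub>R v))) (at (0::real))"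
    if F: "(f has_derivative F) (at x within V)" for F
  proof -
    have "((\<lambda>s. x + s *\<^sub>R v) has_derivative (\<lambda>s. s *\<^sub>R v)) (at (0::real))"
      by (auto intro!: derivative_eq_intros)
    moreover have "(f has_derivative F) (at (x + 0 *\<^sub>R v) within range (\<lambda>s. x + s *\<^sub>R v))"
      using V by (auto intro!: has_derivative_subset[OF F] subspace_add subspace_scale)
    ultimately show ?thesis
      using has_derivative_in_compose by blast
  qed
  from has_derivative_unique[OF this[OF D(1)] this[OF D(2)]]
  have "D (1 *\<^sub>R v) = E (1 *\<^sub>R v)" by (rule fun_cong)
  thus ?thesis by simp
qed

text \<open>Two representatives in \<open>W\<close> of one derivative differ by an element of
  \<open>W\<close> that pairs to zero with \<open>V\<close>; nondegeneracy makes it vanish, which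
  resolves the definite description.\<close>

lemma trace_derivative_eqI:
  fixes V :: "(real^'b^'a) set"
  assumes V: "subspace V" "x \<in> V" and W: "subspace W" "A \<in> W"
    and nondeg: "\<And>Z. Z \<in> W \<Longrightarrow> (\<And>v. v \<in> V \<Longrightarrow> trace (v ** Z) = 0) \<Longrightarrow> Z = 0"
    and A: "(f has_derivative (\<lambda>v. trace (v ** A))) (at x within V)"
  shows "trace_derivative V W f x = A"
  unfolding trace_derivative_def
proof (rule the_equality)
  fix B assume B: "B \<in> W \<and> (f has_derivative (\<lambda>v. trace (v ** B))) (at x within V)"
  have "trace (v ** (B - A)) = 0" if "v \<in> V" for v
  proof -
    have "trace (v ** B) = trace (v ** A)"
      using has_derivative_within_subspace_unique[OF V that _ A] B by blast
    moreover have "trace (v ** B) = trace (v ** (B - A)) + trace (v ** A)"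
      by (simp flip: trace_add matrix_add_ldistrib)
    ultimately show ?thesis by simp
  qed
  hence "B - A = 0"
    using B W by (intro nondeg) (auto intro: subspace_diff)
  thus "B = A" by simp
qed (use assms in auto)

lemma trace_derivative_UNIV_eqI:
  fixes f :: "real^'b^'a \<Rightarrow> real"
  assumes "(f has_derivative (\<lambda>v. trace (v ** A))) (at x)"
  shows "trace_derivative UNIV UNIV f x = A"
proof (rule trace_derivative_eqI)
  fix Z :: "real^'a^'b"
  assume "\<And>v. v \<in> UNIV \<Longrightarrow> trace (v ** Z) = 0"
  \<comment> \<open>The test direction \<open>v = transpose Z\<close> makes the pairing a squared
    Euclidean norm.\<close>
  hence "transpose Z \<bullet> transpose Z = 0" by (simp add: inner_eq_trace)
  hence "transpose (transpose Z) = 0" by (simp add: transpose_def vec_eq_iff)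
  thus "Z = 0" by simp
qed (use assms in auto)

lemma matrix_inv_mul:
  fixes A :: "real^'n^'n"
  assumes "invertible A"
  shows "A ** matrix_inv A = mat 1" "matrix_inv A ** A = mat 1"
  using assms unfolding invertible_def matrix_inv_def by (metis (mono_tags, lifting) someI_ex)+

lemma symmetric_matrix_inv:
  fixes M :: "real^'d^'d"
  assumes "transpose M = M" "det M \<noteq> 0"
  shows "transpose (matrix_inv M) = matrix_inv M"
    "M ** matrix_inv M = mat 1" "matrix_inv M ** M = mat 1"
proof -
  let ?R = "matrix_inv M"
  show *: "M ** ?R = mat 1" "?R ** M = mat 1"
    using matrix_inv_mul[of M] assms(2) by (auto simp: invertible_det_nz)
  have "transpose ?R ** M = mat 1"
    using arg_cong[OF *(1), of transpose] assms(1) by (simp add: matrix_transpose_mul)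
  hence "transpose ?R ** (M ** ?R) = mat 1 ** ?R"
    by (simp add: matrix_mul_assoc)
  thus "transpose ?R = ?R" by (simp add: *)
qed

section \<open>The symplectic Lie algebra and its self-duality under the trace pairing\<close>

locale symplectic_matrix =
  fixes N :: "real^'n^'n"
  assumes invertible: "invertible N" and antisym: "transpose N = - N"
begin

definition Ninv where "Ninv = matrix_inv N"

lemma inverse_mul [simp]: "N ** Ninv = mat 1" "Ninv ** N = mat 1"
  unfolding Ninv_def using matrix_inv_mul[OF invertible] by auto

text \<open>\<open>mat_simps\<close> associates products to the left, so inside a longer product
  \<open>N ** Ninv\<close> is not a subterm and has to be cancelled in this shape.\<close>

lemma cancel [simp]: "B ** N ** Ninv = B" "B ** Ninv ** N = B" for B :: "real^'n^'m"
  by (simp_all add: matrix_mul_assoc[symmetric])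

lemma transpose_Ninv: "transpose Ninv = - Ninv"
  unfolding Ninv_def by (rule matrix_inv_antisym[OF invertible antisym])

lemmas mat_simps = transpose_minus transpose_plus matrix_transpose_mul antisym transpose_Ninv
  matrix_mul_neg_left matrix_mul_neg_right matrix_mul_assoc matrix_add_ldistrib matrix_add_rdistrib
  transpose_diff matrix_diff_ldistrib matrix_diff_rdistrib

text \<open>The Lie algebra \<open>sp_alg (- Ninv)\<close> is the fixed space of this involution, which is
  self-adjoint for the trace pairing.\<close>

definition sp_invol :: "real^'n^'n \<Rightarrow> real^'n^'n" where
  "sp_invol S = - (N ** transpose S ** Ninv)"

lemma sp_iff: "S \<in> sp_alg (- Ninv) \<longleftrightarrow> sp_invol S = S"
  unfolding sp_invol_def Ninv_def sp_alg_iff[OF invertible antisym] by auto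

text \<open>This is the fixed-point equation of \<open>sp_invol\<close> multiplied by
  \<open>N\<close> on the right; the prefix \<open>C\<close> makes it applicable inside
  left-associated products.\<close>

lemma sp_mul_transpose:
  fixes C :: "real^'n^'m"
  assumes "A \<in> sp_alg (- Ninv)"
  shows "C ** N ** transpose A = - (C ** A ** N)"
proof -
  have "N ** transpose A = - (sp_invol A ** N)"
    by (simp add: sp_invol_def matrix_mul_neg_left)
  thus ?thesis
    using assms by (simp add: sp_iff matrix_mul_neg_right flip: matrix_mul_assoc)
qed

lemma sp_invol_sp_invol: "sp_invol (sp_invol S) = S"
  by (simp add: sp_invol_def mat_simps)

lemma sp_invol_add: "sp_invol (A + B) = sp_invol A + sp_invol B"
  by (simp add: sp_invol_def mat_simps)

lemma sp_invol_scaleR: "sp_invol (c *\<^sub>R A) = c *\<^sub>R sp_invol A"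
  by (simp add: sp_invol_def transpose_scalar scalar_matrix_assoc matrix_scalar_ac)

lemma sp_invol_zero: "sp_invol 0 = 0"
  using sp_invol_scaleR[of 0 0] by simp

text \<open>Transposition and cyclicity of the trace move the involution to the other factor; the
  signs of \<open>transpose N\<close> and \<open>transpose Ninv\<close> cancel.\<close>

lemma trace_sp_invol: "trace (A ** sp_invol B) = trace (sp_invol A ** B)"
proof -
  have "trace (A ** sp_invol B) = trace (transpose (A ** sp_invol B))"
    by (simp add: trace_transpose)
  also have "\<dots> = trace ((- (Ninv ** B ** N)) ** transpose A)"
    by (simp add: sp_invol_def mat_simps)
  also have "\<dots> = - trace (Ninv ** (B ** N ** transpose A))"
    by (simp add: mat_simps trace_minus)
  also have "\<dots> = - trace (B ** (N ** transpose A ** Ninv))"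
    by (subst trace_mul_sym) (simp add: mat_simps)
  also have "\<dots> = trace (sp_invol A ** B)"
    by (subst trace_mul_sym) (simp add: sp_invol_def matrix_mul_neg_left trace_minus)
  finally show ?thesis .
qed

text \<open>Averaging over a self-adjoint involution: a matrix and its projection induce the same
  functional on the algebra, so representatives may always be taken inside it.\<close>

definition sp_proj :: "real^'n^'n \<Rightarrow> real^'n^'n" where
  "sp_proj A = (1/2) *\<^sub>R (A + sp_invol A)"

lemma sp_proj_mem: "sp_proj A \<in> sp_alg (- Ninv)"
  by (simp add: sp_iff sp_proj_def sp_invol_add sp_invol_scaleR sp_invol_sp_invol add.commute)

lemma trace_sp_proj: "B \<in> sp_alg (- Ninv) \<Longrightarrow> trace (B ** sp_proj A) = trace (B ** A)"
  by (simp add: sp_iff sp_proj_def matrix_scalar_ac matrix_add_ldistrib trace_add trace_sp_invol trace_scaleR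
      scalar_matrix_assoc[symmetric])

lemma subspace_sp: "subspace (sp_alg (- Ninv))"
  by (auto simp: subspace_def sp_iff sp_invol_add sp_invol_scaleR sp_invol_zero)

text \<open>The natural test element \<open>transpose Z\<close> need not lie in the algebra; its
  projection does and has the same pairing with \<open>Z\<close>, namely the squared norm of
  \<open>Z\<close>.\<close>

lemma sp_nondegenerate:
  assumes Z: "Z \<in> sp_alg (- Ninv)" and 0: "\<And>S. S \<in> sp_alg (- Ninv) \<Longrightarrow> trace (S ** Z) = 0"
  shows "Z = 0"
proof -
  have "trace (Z ** transpose Z) = trace (Z ** sp_proj (transpose Z))"
    using trace_sp_proj[OF Z] by simp
  also have "\<dots> = 0"
    using 0[OF sp_proj_mem] by (metis trace_mul_sym)
  finally show ?thesis by (rule trace_mul_transpose_eq_0)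
qed

lemma linear_functional_sp:
  fixes D :: "real^'n^'n \<Rightarrow> real"
  assumes "linear D"
  obtains A where "A \<in> sp_alg (- Ninv)" "\<And>S. S \<in> sp_alg (- Ninv) \<Longrightarrow> D S = trace (S ** A)"
proof -
  obtain B where "\<And>V. D V = trace (V ** B)"
    using linear_functional_eq_trace[OF assms] by metis
  thus ?thesis using that[OF sp_proj_mem, of B] by (simp add: trace_sp_proj)
qed

text \<open>A derivative within the algebra is tested only on increments \<open>Y - X\<close> inside
  it, so \<open>D\<close> may be replaced by a trace functional that agrees with it there.\<close>

lemma delta_X_eqI:
  assumes "X \<in> sp_alg (- Ninv)" "A \<in> sp_alg (- Ninv)"
    and "((\<lambda>Y. h (Y, K, M)) has_derivative D) (at X within sp_alg (- Ninv))"
    and "\<And>S. S \<in> sp_alg (- Ninv) \<Longrightarrow> D S = trace (S ** A)"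
  shows "delta_X (- Ninv) h X K M = A"
  unfolding delta_X_def
proof (rule trace_derivative_eqI)
  show "((\<lambda>Y. h (Y, K, M)) has_derivative (\<lambda>S. trace (S ** A))) (at X within sp_alg (- Ninv))"
  proof -
    have "D (Y - X) = trace ((Y - X) ** A)" if "Y \<in> sp_alg (- Ninv)" for Y
      using that assms(1,4) subspace_sp by (simp add: subspace_diff)
    moreover have "bounded_linear (\<lambda>S. trace (S ** A))"
      by (intro bounded_linear_compose[OF bounded_linear_trace]
          bounded_bilinear.bounded_linear_left[OF bounded_bilinear_matrix_mul])
    ultimately show ?thesis
      using assms(3) unfolding has_derivative_within'
      by auto
  qed
qed (use assms subspace_sp sp_nondegenerate in auto)

section \<open>The quadratic map in the first component of \<open>Psi N\<close>\<close>

definition collective_X where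
  "collective_X M L = -(1/2) *\<^sub>R (N ** transpose L ** matrix_inv M ** L)"
  for M :: "real^'d^'d" and L :: "real^'n^'d"

definition collective_X' where
  "collective_X' M L V =
    -(1/2) *\<^sub>R (N ** transpose V ** matrix_inv M ** L + N ** transpose L ** matrix_inv M ** V)"
  for M :: "real^'d^'d" and L :: "real^'n^'d"

lemma has_derivative_collective_X: "(collective_X M has_derivative collective_X' M L) (at L within S)"
  for M :: "real^'d^'d"
proof -
  note b = bounded_bilinear.FDERIV[OF bounded_bilinear_matrix_mul]
  have "((\<lambda>L. N ** transpose L ** matrix_inv M) has_derivative
      (\<lambda>V. N ** transpose V ** matrix_inv M)) (at L within S)"
    by (intro bounded_linear_imp_has_derivative
          bounded_linear_compose[OF bounded_bilinear.bounded_linear_left[OF bounded_bilinear_matrix_mul]]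
          bounded_linear_compose[OF bounded_bilinear.bounded_linear_right[OF bounded_bilinear_matrix_mul]]
          bounded_linear_transpose)
  from has_derivative_scaleR_right[OF b[OF this has_derivative_ident], of "-(1/2)"]
  show ?thesis unfolding collective_X_def[abs_def] collective_X'_def[abs_def] by (simp add: add.commute)
qed

text \<open>\<open>N ** S\<close> is fixed by \<open>sp_invol\<close> when \<open>S\<close> is
  symmetric, and \<open>transpose L ** matrix_inv M ** L\<close> is symmetric along with
  \<open>M\<close>.\<close>

lemma collective_X_mem:
  fixes M :: "real^'d^'d"
  assumes "transpose M = M" "det M \<noteq> 0"
  shows "collective_X M L \<in> sp_alg (- Ninv)"
  using symmetric_matrix_inv[OF assms]
  by (simp add: sp_iff collective_X_def sp_invol_def mat_simps transpose_scalar scalar_matrix_assoc matrix_scalar_ac)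

text \<open>The involution exchanges the two summands of the product rule, so their half sum is a
  projection.\<close>

lemma collective_X'_eq_sp_proj:
  fixes M :: "real^'d^'d"
  assumes "transpose M = M" "det M \<noteq> 0"
  shows "collective_X' M L V = - sp_proj (N ** transpose L ** matrix_inv M ** V)"
proof -
  have "sp_invol (N ** transpose L ** matrix_inv M ** V) = N ** transpose V ** matrix_inv M ** L"
    using symmetric_matrix_inv[OF assms] by (simp add: sp_invol_def mat_simps)
  thus ?thesis
    by (simp add: collective_X'_def sp_proj_def add.commute)
qed

lemma collective_X'_mem:
  fixes M :: "real^'d^'d"
  assumes "transpose M = M" "det M \<noteq> 0"
  shows "collective_X' M L V \<in> sp_alg (- Ninv)"
  unfolding collective_X'_eq_sp_proj[OF assms] by (rule subspace_neg[OF subspace_sp sp_proj_mem])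

text \<open>Computes the adjoint of the derivative of the quadratic map; its value at
  \<open>A\<close> is the correction term of the collective derivative.\<close>

lemma trace_collective_X':
  fixes M :: "real^'d^'d"
  assumes "transpose M = M" "det M \<noteq> 0" and A: "A \<in> sp_alg (- Ninv)"
  shows "trace (collective_X' M L V ** A) = - trace (V ** (A ** N ** transpose L ** matrix_inv M))"
proof -
  have "trace (collective_X' M L V ** A) = - trace (A ** sp_proj (N ** transpose L ** matrix_inv M ** V))"
    by (subst trace_mul_sym)
       (simp add: collective_X'_eq_sp_proj[OF assms(1,2)] matrix_mul_neg_right trace_minus)
  also have "\<dots> = - trace (A ** N ** transpose L ** matrix_inv M ** V)"
    by (simp add: trace_sp_proj[OF A] matrix_mul_assoc)
  finally show ?thesis
    by (subst (2) trace_mul_sym)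
qed

text \<open>With \<open>A\<close> and \<open>B\<close> standing for the derivatives of
  \<open>h\<close>, the derivative of the quadratic map sends the Lie--Poisson velocity of
  \<open>K\<close> to that of \<open>X\<close>: the terms in \<open>A\<close> give the commutator,
  those in \<open>B\<close> the diamond.\<close>

lemma collective_X_transport:
  fixes M :: "real^'d^'d"
  assumes M: "transpose M = M" "det M \<noteq> 0" and A: "A \<in> sp_alg (- Ninv)"
  shows "collective_X' M K (K ** A - M ** transpose B ** Ninv) =
    (collective_X M K ** A - A ** collective_X M K) - diamond (- Ninv) B K"
proof -
  let ?R = "matrix_inv M" and ?V = "K ** A - M ** transpose B ** Ninv"
  note R = symmetric_matrix_inv[OF M]
  have cancel_R: "C ** ?R ** M = C" "C ** M ** ?R = C" for C :: "real^'d^'m"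
    using R by (simp_all add: matrix_mul_assoc[symmetric])
  define Q where "Q = N ** transpose K ** ?R ** K"
  define C where "C = N ** transpose K ** transpose B ** Ninv"
  \<comment> \<open>Membership of \<open>A\<close> in the algebra supplies the sign that makes the
    \<open>A\<close>-terms below a commutator.\<close>
  have AN: "N ** transpose A = - (A ** N)"
    using sp_mul_transpose[OF A, of "mat 1"] by simp
  have "N ** transpose ?V ** ?R ** K = B ** K - A ** Q"
    using M(1) by (simp add: mat_simps cancel_R AN Q_def)
  moreover have "N ** transpose K ** ?R ** ?V = Q ** A - C"
    by (simp add: mat_simps cancel_R Q_def C_def)
  moreover have "diamond (- Ninv) B K = (1/2) *\<^sub>R (B ** K - C)"
    by (simp add: diamond_explicit[OF invertible antisym, folded Ninv_def] sym_part_def C_def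
        scalar_matrix_assoc[symmetric] mat_simps)
  moreover have "collective_X M K = (-(1/2)) *\<^sub>R Q"
    by (simp add: collective_X_def Q_def)
  ultimately show ?thesis
    by (simp add: collective_X'_def scalar_matrix_assoc[symmetric] matrix_scalar_ac matrix_mul_neg_left
        matrix_mul_neg_right scaleR_diff_right scaleR_add_right)
qed

section \<open>The chain rule for the collective Hamiltonian\<close>

lemma heis_delta_K_collective:
  fixes h :: "(real^'n^'n) \<times> (real^'n^'d) \<times> (real^'d^'d) \<Rightarrow> real"
  assumes M: "transpose M = M" "det M \<noteq> 0"
    and h: "h differentiable (at (collective_X M K, K, M) within jac_dual (- Ninv))"
  defines "dX \<equiv> delta_X (- Ninv) h (collective_X M K) K M" and "dK \<equiv> delta_K h (collective_X M K) K M"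
  shows "dX \<in> sp_alg (- Ninv)"
    and "heis_delta_K (h \<circ> Psi N) K M = dK - dX ** N ** transpose K ** matrix_inv M"
proof -
  obtain D where D: "(h has_derivative D) (at (collective_X M K, K, M) within jac_dual (- Ninv))"
    using h unfolding differentiable_def by blast
  \<comment> \<open>As \<open>h\<close> is differentiated within \<open>jac_dual (- Ninv)\<close>,
    inner maps must take values there; the partial maps and the map into the image of
    \<open>Psi N\<close> all do.\<close>
  have compose: "((\<lambda>y. h (f y)) has_derivative (\<lambda>v. D (f' v))) (at x within S)"
    if "(f has_derivative f') (at x within S)" "f x = (collective_X M K, K, M)" "f ` S \<subseteq> jac_dual (- Ninv)"
    for f f' x and S :: "'z::real_normed_vector set"
    using has_derivative_in_compose[OF that(1)] has_derivative_subset[OF D that(3)] that(2) by simp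
  have lin: "linear D" using D by (rule has_derivative_linear)
  have lin0: "linear (\<lambda>S. D (S, 0, 0))" "linear (\<lambda>V. D (0, V, 0))"
    by (rule linear_compose[OF _ lin, unfolded o_def], simp add: linear_iff)+
  obtain A where A: "A \<in> sp_alg (- Ninv)" "\<And>S. S \<in> sp_alg (- Ninv) \<Longrightarrow> D (S, 0, 0) = trace (S ** A)"
    using linear_functional_sp[OF lin0(1)] by metis
  obtain B where B: "\<And>V. D (0, V, 0) = trace (V ** B)"
    using linear_functional_eq_trace[OF lin0(2)] by metis
  have mem: "(Y, L, M) \<in> jac_dual (- Ninv)" if "Y \<in> sp_alg (- Ninv)" for Y L
    using that M by (simp add: jac_dual_def sym_mats_def)
  have dX: "dX = A"
    unfolding dX_def
    by (rule delta_X_eqI[OF collective_X_mem[OF M] A(1) compose[of "\<lambda>Y. (Y, K, M)"] A(2)])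
       (auto simp: zero_prod_def intro!: derivative_eq_intros mem)
  thus "dX \<in> sp_alg (- Ninv)" using A by simp
  have dK: "dK = B"
    unfolding dK_def delta_K_def
    by (rule trace_derivative_UNIV_eqI, unfold B[symmetric],
        rule compose[of "\<lambda>L. (collective_X M K, L, M)"])
       (auto simp: zero_prod_def intro!: derivative_eq_intros mem collective_X_mem M)
  have "((\<lambda>L. h (collective_X M L, L, M)) has_derivative (\<lambda>V. D (collective_X' M K V, V, 0))) (at K)"
    by (rule compose[of "\<lambda>L. (collective_X M L, L, M)"])
       (auto simp: zero_prod_def intro!: derivative_eq_intros has_derivative_collective_X mem collective_X_mem M)
  moreover have "D (collective_X' M K V, V, 0) =
      trace (V ** (dK - dX ** N ** transpose K ** matrix_inv M))" for V
  proof -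
    note collective_X'_mem[OF M, of K V]
    \<comment> \<open>Linearity separates the two slots; the first increment lies in the algebra,
      where \<open>A\<close> represents \<open>D\<close>.\<close>
    moreover have "D (collective_X' M K V, V, 0) = D (collective_X' M K V, 0, 0) + D (0, V, 0)"
      by (simp flip: linear_add[OF lin])
    ultimately show ?thesis
      using A B trace_collective_X'[OF M A(1)] dX dK
      by (simp add: matrix_diff_ldistrib trace_sub)
  qed
  ultimately show "heis_delta_K (h \<circ> Psi N) K M = dK - dX ** N ** transpose K ** matrix_inv M"
    unfolding heis_delta_K_def
    by (intro trace_derivative_UNIV_eqI) (simp add: Psi_def collective_X_def)
qed

end

section \<open>Time evolution along a collective solution\<close>

theorem corollary2p11:
  fixes N :: "real^'n^'n"
    and k :: nat
    and h :: "(real^'n^'n) \<times> (real^'n^'d) \<times> (real^'d^'d) \<Rightarrow> real"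
    and K :: "real \<Rightarrow> real^'n^'d"
    and M :: "real \<Rightarrow> real^'d^'d"
    and I :: "real set"
  assumes "CARD('n) = 2 * k"
    and "invertible N"
    and "transpose N = - N"
    and "smooth_on_subspace (jac_dual (- matrix_inv N)) h"
    and "is_interval I"
    and "collective_solution N (h \<circ> Psi N) I K M"
  shows "lie_poisson_solution N h I
           (\<lambda>t. -(1/2) *\<^sub>R (N ** transpose (K t) ** matrix_inv (M t) ** K t)) K M"
proof -
  interpret symplectic_matrix N
    using assms(2,3) by unfold_locales
  note sol = assms(6)[unfolded collective_solution_def heis_dual_nondeg_def sym_mats_def, folded Ninv_def]
  have smooth: "Cn_on (Suc 0) (jac_dual (- Ninv)) h"
    using assms(4) unfolding smooth_on_subspace_def Ninv_def by blast
  \<comment> \<open>An interval is convex, so the zero derivative forces \<open>M\<close> to be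
    constant; this avoids differentiating \<open>matrix_inv (M s)\<close>.\<close>
  have "\<exists>M0. \<forall>t\<in>I. M t = M0"
    using assms(5) sol by (metis has_vector_derivative_zero_constant is_interval_convex)
  then obtain M0 where M0: "\<And>t. t \<in> I \<Longrightarrow> M t = M0" by blast
  show ?thesis
    unfolding lie_poisson_solution_def Let_def Ninv_def[symmetric] collective_X_def[symmetric]
  proof (intro ballI)
    fix t assume t: "t \<in> I"
    define dX where "dX = delta_X (- Ninv) h (collective_X (M t) (K t)) (K t) (M t)"
    define dK where "dK = delta_K h (collective_X (M t) (K t)) (K t) (M t)"
    have M: "transpose (M t) = M t" "det (M t) \<noteq> 0" using sol t by auto
    note R = symmetric_matrix_inv[OF M]
    have jac: "(collective_X (M t) (K t), K t, M t) \<in> jac_dual (- Ninv)"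
      using collective_X_mem[OF M] M by (simp add: jac_dual_def sym_mats_def)
    hence diff: "h differentiable (at (collective_X (M t) (K t), K t, M t) within jac_dual (- Ninv))"
      using smooth by simp
    note coll = heis_delta_K_collective[OF M diff, folded dX_def dK_def]
    \<comment> \<open>Multiplied by \<open>M t\<close> on the left and \<open>Ninv\<close> on the
      right, this becomes the term \<open>K t ** dX\<close> of the Lie--Poisson equation.\<close>
    have "transpose (dX ** N ** transpose (K t) ** matrix_inv (M t)) = matrix_inv (M t) ** K t ** dX ** N"
      using R by (simp add: mat_simps sp_mul_transpose[OF coll(1)])
    hence vf: "- (M t ** transpose (heis_delta_K (h \<circ> Psi N) (K t) (M t)) ** Ninv) =
        K t ** dX - M t ** transpose dK ** Ninv"
      using R by (simp add: coll(2) mat_simps)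
    have "(K has_vector_derivative - (M t ** transpose (heis_delta_K (h \<circ> Psi N) (K t) (M t)) ** Ninv))
        (at t within I)"
      using sol t by blast
    hence K': "(K has_vector_derivative K t ** dX - M t ** transpose dK ** Ninv) (at t within I)"
      by (simp only: vf)
    \<comment> \<open>With the parameter frozen at \<open>M0\<close>, time enters only through
      \<open>K\<close>; on \<open>I\<close> this curve agrees with the actual one.\<close>
    have "((\<lambda>s. collective_X M0 (K s)) has_vector_derivative
        collective_X' M0 (K t) (K t ** dX - M t ** transpose dK ** Ninv))
        (at t within I)"
      unfolding has_vector_derivative_def
      by (rule has_derivative_eq_rhs[OF has_derivative_in_compose[OF
              K'[unfolded has_vector_derivative_def] has_derivative_collective_X]])
         (simp only: linear_scale[OF has_derivative_linear[OF has_derivative_collective_X]])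
    hence "((\<lambda>s. collective_X (M s) (K s)) has_vector_derivative
        (collective_X (M t) (K t) ** dX - dX ** collective_X (M t) (K t))
          - diamond (- Ninv) dK (K t)) (at t within I)"
      using has_vector_derivative_transform[OF t, of "\<lambda>s. collective_X (M s) (K s)"
            "\<lambda>s. collective_X M0 (K s)"]
        M0 t collective_X_transport[OF M coll(1), of "K t" dK] by auto
    moreover have "(M has_vector_derivative 0) (at t within I)"
      using sol t by blast
    ultimately show "(collective_X (M t) (K t), K t, M t) \<in> jac_dual (- Ninv) \<and>
       ((\<lambda>t. collective_X (M t) (K t)) has_vector_derivative
          (collective_X (M t) (K t) ** delta_X (- Ninv) h (collective_X (M t) (K t)) (K t) (M t)
            - delta_X (- Ninv) h (collective_X (M t) (K t)) (K t) (M t) ** collective_X (M t) (K t))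
          - diamond (- Ninv) (delta_K h (collective_X (M t) (K t)) (K t) (M t)) (K t)) (at t within I) \<and>
       (K has_vector_derivative
          K t ** delta_X (- Ninv) h (collective_X (M t) (K t)) (K t) (M t)
          - M t ** transpose (delta_K h (collective_X (M t) (K t)) (K t) (M t)) ** Ninv) (at t within I) \<and>
       (M has_vector_derivative 0) (at t within I)"
      using jac K' unfolding dX_def dK_def by (intro conjI)
  qed
qed

end
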